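(* Let $a>0$. There exists a positive constant $K$, depending on $a$, such that for all integers $n\ge 2$ with $[an]\ge 2$ and all $y\in\{1,\dots,n-1\}$, $$f(1,y) \leq K\frac{y}{n^2},$$ where $f:\bar R([an],n)\to\mathbb{R}$ is the solution of the discrete Dirichlet problem in $R([an],n)$ with boundary value $1$ on the side $\{([an],y'):1\le y'\le n-1\}$ and $0$ on the rest of the boundary, i.e. $\Delta f=0$ in $R([an],n)$, $f=1$ on $\{([an],y'):1\le y'\le n-1\}$, and $f=0$ on $\partial R([an],n)\setminus\{([an],y'):1\le y'\le n-1\}$.
   Context: $[\cdot]$ denotes the integer part. $R(l,n)=\{(x,y) \in \mathbb{Z}^2:1\leq x\leq l-1,\ 1\leq y \leq n-1\}$. The boundary of a set $D\subset\mathbb{Z}^2$ is $\partial D=\{w\in\mathbb{Z}^2: w\notin D,\ \exists z\in D \text{ with } |z-w|=1\}$ ($|\cdot|$ the Euclidean norm), and $\bar{R}(l,n)=R(l,n)\cup\partial R(l,n)$. The discrete Laplacian is $\Delta f(x,y)=\frac14\sum (f(x',y')-f(x,y))$, the sum being over the four $(x',y')\in\mathbb{Z}^2$ with $|(x',y')-(x,y)|=1$. *)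

theory Defs
  imports "HOL-Analysis.Analysis"
begin

(* The library norm on real * real is the Euclidean one. *)
definition lattice_dist :: "int \<times> int \<Rightarrow> int \<times> int \<Rightarrow> real" where
  "lattice_dist z w = norm (real_of_int (fst z - fst w), real_of_int (snd z - snd w))"

definition lattice_boundary :: "(int \<times> int) set \<Rightarrow> (int \<times> int) set" where
  "lattice_boundary D = {w. w \<notin> D \<and> (\<exists>z\<in>D. lattice_dist z w = 1)}"

definition discrete_laplacian :: "(int \<times> int \<Rightarrow> real) \<Rightarrow> int \<times> int \<Rightarrow> real" where
  "discrete_laplacian f z = 1 / 4 * (\<Sum>w | lattice_dist w z = 1. f w - f z)"

definition rect :: "int \<Rightarrow> int \<Rightarrow> (int \<times> int) set" where
  "rect l n = {(x, y). 1 \<le> x \<and> x \<le> l - 1 \<and> 1 \<le> y \<and> y \<le> n - 1}"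

definition right_side :: "int \<Rightarrow> int \<Rightarrow> (int \<times> int) set" where
  "right_side l n = {(x, y). x = l \<and> 1 \<le> y \<and> y \<le> n - 1}"

(* A function on the closed rectangle (rect together with its boundary) is represented by a
   total function whose values elsewhere are arbitrary; all conditions below only involve
   values on the closed rectangle, see rect_dirichlet_solution_cong. *)
definition rect_dirichlet_solution :: "int \<Rightarrow> int \<Rightarrow> (int \<times> int \<Rightarrow> real) \<Rightarrow> bool" where
  "rect_dirichlet_solution l n f \<longleftrightarrow>
     (\<forall>z\<in>rect l n. discrete_laplacian f z = 0) \<and>
     (\<forall>z\<in>right_side l n. f z = 1) \<and>
     (\<forall>z\<in>lattice_boundary (rect l n) - right_side l n. f z = 0)"

lemma lattice_dist_commute: "lattice_dist z w = lattice_dist w z"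
  by (simp add: lattice_dist_def norm_Pair power2_commute)

lemma right_side_subset_boundary:
  assumes "l \<ge> 2"
  shows "right_side l n \<subseteq> lattice_boundary (rect l n)"
proof
  fix w assume "w \<in> right_side l n"
  then obtain y where w: "w = (l, y)" "1 \<le> y" "y \<le> n - 1"
    by (auto simp: right_side_def)
  have "(l - 1, y) \<in> rect l n" "lattice_dist (l - 1, y) w = 1"
    using assms w by (auto simp: rect_def lattice_dist_def norm_Pair)
  moreover have "w \<notin> rect l n" using w by (simp add: rect_def)
  ultimately show "w \<in> lattice_boundary (rect l n)"
    unfolding lattice_boundary_def by blast
qed

lemma rect_dirichlet_solution_cong:
  assumes "l \<ge> 2"
    and eq: "\<And>z. z \<in> rect l n \<union> lattice_boundary (rect l n) \<Longrightarrow> f z = g z"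
  shows "rect_dirichlet_solution l n f \<longleftrightarrow> rect_dirichlet_solution l n g"
proof -
  have "discrete_laplacian f z = discrete_laplacian g z" if z: "z \<in> rect l n" for z
  proof -
    have "f w - f z = g w - g z" if "lattice_dist w z = 1" for w
    proof -
      have "lattice_dist z w = 1" using that by (simp add: lattice_dist_commute)
      then have "w \<in> rect l n \<union> lattice_boundary (rect l n)"
        using z unfolding lattice_boundary_def by blast
      then show ?thesis using z eq by simp
    qed
    then show ?thesis by (simp add: discrete_laplacian_def)
  qed
  moreover have "f z = g z" if "z \<in> right_side l n" for z
    using that eq right_side_subset_boundary[OF assms(1)] by blast
  moreover have "f z = g z" if "z \<in> lattice_boundary (rect l n) - right_side l n" for z
    using that eq by blast
  ultimately show ?thesis
    unfolding rect_dirichlet_solution_def by simp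
qed

end

theory Submission
  imports Defs
begin

text \<open>
  For every \<open>c\<close> the polynomial \<open>(x - c)\<^sup>2 + y (n - y)\<close> is discrete harmonic; it is nonnegative on
  the boundary of the rectangle and at least \<open>(l - c)\<^sup>2\<close> on the right side. The maximum principle,
  evaluated at \<open>x = c\<close>, gives \<open>f(c, y) \<le> y (n - y) / (l - c)\<^sup>2\<close>, which is of order \<open>y / n\<close> at
  \<open>c = m \<approx> l / 2\<close>. A multiple of the harmonic function \<open>x y\<close> then dominates \<open>f\<close> on the left half
  \<open>{0..m} \<times> {0..n}\<close>, and this supplies the missing factor \<open>1 / n\<close> at \<open>x = 1\<close>.
\<close>

text \<open>The squared distance is a sum of two integer squares. If it is 1, each difference lies
  in {-1, 0, 1}, which leaves finitely many cases.\<close>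

lemma lattice_dist_eq_1_iff:
  "lattice_dist w (x, y) = 1 \<longleftrightarrow> w \<in> {(x + 1, y), (x - 1, y), (x, y + 1), (x, y - 1)}"
proof -
  obtain u v where w: "w = (u, v)" by fastforce
  have "p\<^sup>2 + q\<^sup>2 = 1 \<longleftrightarrow> (\<bar>p\<bar> = 1 \<and> q = 0) \<or> (p = 0 \<and> \<bar>q\<bar> = 1)" for p q :: int
  proof
    assume eq: "p\<^sup>2 + q\<^sup>2 = 1"
    have "p\<^sup>2 \<le> 1\<^sup>2" "q\<^sup>2 \<le> 1\<^sup>2"
      using eq zero_le_power2[of p] zero_le_power2[of q] unfolding power_one by linarith+
    then have "\<bar>p\<bar> \<le> 1" "\<bar>q\<bar> \<le> 1"
      using abs_le_square_iff[of p 1] abs_le_square_iff[of q 1] by simp_all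
    then have "p \<in> {-1, 0, 1}" "q \<in> {-1, 0, 1}" by auto
    then show "(\<bar>p\<bar> = 1 \<and> q = 0) \<or> (p = 0 \<and> \<bar>q\<bar> = 1)" using eq by auto
  next
    assume "(\<bar>p\<bar> = 1 \<and> q = 0) \<or> (p = 0 \<and> \<bar>q\<bar> = 1)"
    then show "p\<^sup>2 + q\<^sup>2 = 1"
      by (metis add.right_neutral add_0 one_power2 power2_abs power_zero_numeral)
  qed
  from this[of "u - x" "v - y"]
  have "(u - x)\<^sup>2 + (v - y)\<^sup>2 = 1 \<longleftrightarrow> w \<in> {(x + 1, y), (x - 1, y), (x, y + 1), (x, y - 1)}"
    by (auto simp: w)
  moreover have "lattice_dist w (x, y) = 1 \<longleftrightarrow> real_of_int ((u - x)\<^sup>2 + (v - y)\<^sup>2) = real_of_int 1"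
    by (simp add: w lattice_dist_def norm_Pair)
  ultimately show ?thesis by (simp only: of_int_eq_iff)
qed

lemma discrete_laplacian_eq:
  "discrete_laplacian f (x, y) =
    (f (x + 1, y) + f (x - 1, y) + f (x, y + 1) + f (x, y - 1) - 4 * f (x, y)) / 4"
proof -
  have "{w. lattice_dist w (x, y) = 1} = {(x + 1, y), (x - 1, y), (x, y + 1), (x, y - 1)}"
    by (auto simp: lattice_dist_eq_1_iff)
  then show ?thesis by (simp add: discrete_laplacian_def)
qed

lemma discrete_laplacian_diff:
  "discrete_laplacian (\<lambda>z. f z - g z) z = discrete_laplacian f z - discrete_laplacian g z"
  by (cases z) (simp add: discrete_laplacian_eq field_simps)

lemma neighbour_in_closure:
  assumes "(x, y) \<in> D" "w \<in> {(x + 1, y), (x - 1, y), (x, y + 1), (x, y - 1)}"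
  shows "w \<in> D \<union> lattice_boundary D"
proof -
  have "lattice_dist (x, y) w = 1"
    using assms(2) unfolding lattice_dist_commute[of _ w] lattice_dist_eq_1_iff .
  then show ?thesis using assms(1) unfolding lattice_boundary_def by blast
qed

lemma discrete_maximum_principle:
  assumes "finite D"
    and sub: "\<And>z. z \<in> D \<Longrightarrow> discrete_laplacian h z \<ge> 0"
    and bd: "\<And>z. z \<in> lattice_boundary D \<Longrightarrow> h z \<le> 0"
    and "z \<in> D"
  shows "h z \<le> 0"
proof (rule ccontr)
  assume "\<not> h z \<le> 0"
  define M where "M = Max (h ` D)"
  have le_M: "h w \<le> M" if "w \<in> D" for w
    using that \<open>finite D\<close> by (simp add: M_def)
  have "M > 0" using le_M[OF \<open>z \<in> D\<close>] \<open>\<not> h z \<le> 0\<close> by simp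
  \<comment> \<open>The contradiction comes from a maximiser as far to the right as possible.\<close>
  define A where "A = {w \<in> D. h w = M}"
  have "M \<in> h ` D" unfolding M_def using assms by (intro Max_in) auto
  then have "finite A" "A \<noteq> {}" using \<open>finite D\<close> by (auto simp: A_def)
  then have "Max (fst ` A) \<in> fst ` A" by (intro Max_in) auto
  then obtain p where "p \<in> A" and Max_p: "Max (fst ` A) = fst p" by blast
  have right: "fst w \<le> fst p" if "w \<in> A" for w
    using that \<open>finite A\<close> unfolding Max_p[symmetric] by (intro Max_ge) auto
  obtain x y where p: "p = (x, y)" by fastforce
  have xy: "(x, y) \<in> D" "h (x, y) = M" using \<open>p \<in> A\<close> by (auto simp: A_def p)
  have nb: "h w \<le> M" if "w \<in> {(x + 1, y), (x - 1, y), (x, y + 1), (x, y - 1)}" for w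
    using neighbour_in_closure[OF xy(1) that] le_M[of w] bd[of w] \<open>M > 0\<close> by auto
  \<comment> \<open>By \<open>sub\<close>, four times the value \<open>M\<close> at
    \<open>(x, y)\<close> is at most the sum over the neighbours. Three of them contribute at most
    \<open>M\<close> each, so the right one contributes at least \<open>M\<close>.\<close>
  have "h (x + 1, y) \<ge> M"
    using sub[OF xy(1)] xy(2) nb[of "(x - 1, y)"] nb[of "(x, y + 1)"] nb[of "(x, y - 1)"]
    by (simp add: discrete_laplacian_eq)
  \<comment> \<open>The right neighbour cannot be a boundary point, where \<open>h\<close> is at
    most 0 and hence below \<open>M\<close>.\<close>
  then have "(x + 1, y) \<in> A"
    using neighbour_in_closure[OF xy(1), of "(x + 1, y)"] nb[of "(x + 1, y)"] bd[of "(x + 1, y)"] \<open>M > 0\<close>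
    by (auto simp: A_def)
  then show False using right[of "(x + 1, y)"] p by simp
qed

lemma finite_rect: "finite (rect l n)"
  by (rule finite_subset[of _ "{1..l - 1} \<times> {1..n - 1}"]) (auto simp: rect_def)

text \<open>The four corners are excluded: none of them has a neighbour inside the
  rectangle.\<close>

lemma lattice_boundary_rectD:
  assumes "(x, y) \<in> lattice_boundary (rect l n)"
  shows "(x \<in> {0, l} \<and> y \<in> {1..n - 1}) \<or> (y \<in> {0, n} \<and> x \<in> {1..l - 1})"
proof -
  obtain u v where uv: "(u, v) \<in> rect l n" "(x, y) \<notin> rect l n" "lattice_dist (u, v) (x, y) = 1"
    using assms by (auto simp: lattice_boundary_def)
  then show ?thesis
    by (auto simp: lattice_dist_eq_1_iff rect_def)
qed

text \<open>The maximum principle for \<open>f - g\<close>. It serves both the quadratic majorant on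
  the whole rectangle and the multiple of \<open>x y\<close> on the left part.\<close>

lemma rect_comparison:
  assumes f: "\<And>z. z \<in> rect l n \<Longrightarrow> discrete_laplacian f z = 0"
    and g: "\<And>z. z \<in> rect l n \<Longrightarrow> discrete_laplacian g z = 0"
    and horizontal: "\<And>x y. x \<in> {1..l - 1} \<Longrightarrow> y \<in> {0, n} \<Longrightarrow> f (x, y) \<le> g (x, y)"
    and vertical: "\<And>x y. x \<in> {0, l} \<Longrightarrow> y \<in> {1..n - 1} \<Longrightarrow> f (x, y) \<le> g (x, y)"
    and z: "z \<in> rect l n"
  shows "f z \<le> (g z :: real)"
proof -
  have "f z - g z \<le> 0"
  proof (rule discrete_maximum_principle[OF finite_rect _ _ z])
    show "discrete_laplacian (\<lambda>z. f z - g z) w \<ge> 0" if "w \<in> rect l n" for w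
      using f[OF that] g[OF that] by (simp add: discrete_laplacian_diff)
    show "f w - g w \<le> 0" if "w \<in> lattice_boundary (rect l n)" for w
      using lattice_boundary_rectD[of "fst w" "snd w" l n] that
        horizontal[of "fst w" "snd w"] vertical[of "fst w" "snd w"] by auto
  qed
  then show ?thesis by simp
qed

context
  fixes l n :: int and f :: "int \<times> int \<Rightarrow> real"
  assumes sol: "rect_dirichlet_solution l n f"
begin

lemma dirichlet_harmonic: "z \<in> rect l n \<Longrightarrow> discrete_laplacian f z = 0"
  using sol by (simp add: rect_dirichlet_solution_def)

lemma dirichlet_right: "y \<in> {1..n - 1} \<Longrightarrow> f (l, y) = 1"
  using sol by (auto simp: rect_dirichlet_solution_def right_side_def)

text \<open>The zero condition speaks of \<open>lattice_boundary\<close>, so an interior neighbour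
  has to be exhibited: \<open>(1, y)\<close>, which is inside because \<open>l\<close> is at least
  2.\<close>

lemma dirichlet_left:
  assumes "l \<ge> 2" "y \<in> {1..n - 1}"
  shows "f (0, y) = 0"
proof -
  have "(1, y) \<in> rect l n" "(0, y) \<notin> rect l n" "(0, y) \<notin> right_side l n"
    using assms by (auto simp: rect_def right_side_def)
  then show ?thesis
    using sol neighbour_in_closure[of 1 y "rect l n" "(0, y)"]
    by (auto simp: rect_dirichlet_solution_def)
qed

lemma dirichlet_horizontal:
  assumes "n \<ge> 2" "x \<in> {1..l - 1}" "y \<in> {0, n}"
  shows "f (x, y) = 0"
proof -
  have "(x, 1) \<in> rect l n" "(x, n - 1) \<in> rect l n" "(x, y) \<notin> rect l n" "(x, y) \<notin> right_side l n"
    using assms by (auto simp: rect_def right_side_def)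
  then show ?thesis
    using sol neighbour_in_closure[of x 1 "rect l n" "(x, y)"]
      neighbour_in_closure[of x "n - 1" "rect l n" "(x, y)"] assms(3)
    by (auto simp: rect_dirichlet_solution_def)
qed

lemma dirichlet_bound_vertical_line:
  assumes n: "n \<ge> 2" and c: "c \<in> {1..l - 1}" and y: "y \<in> {1..n - 1}"
  shows "f (c, y) \<le> of_int (y * (n - y)) / (of_int (l - c))\<^sup>2"
proof -
  \<comment> \<open>The second differences 2 of \<open>(x - c)^2\<close> and -2 of
    \<open>y (n - y)\<close> cancel. The divisor normalises the majorant to at least 1 on the right
    side, and the square vanishes on the line \<open>x = c\<close>.\<close>
  define g :: "int \<times> int \<Rightarrow> real"
    where "g = (\<lambda>(x, y). ((of_int (x - c))\<^sup>2 + of_int (y * (n - y))) / (of_int (l - c))\<^sup>2)"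
  have "f (c, y) \<le> g (c, y)"
  proof (rule rect_comparison[of l n])
    show "discrete_laplacian g z = 0" for z
      by (cases z) (simp add: discrete_laplacian_eq g_def power2_eq_square
          add_divide_distrib[symmetric] diff_divide_distrib[symmetric] algebra_simps)
    show "f (x, y) \<le> g (x, y)" if "x \<in> {1..l - 1}" "y \<in> {0, n}" for x y
      using that dirichlet_horizontal[OF n that] by (auto simp: g_def)
    show "f (x, y) \<le> g (x, y)" if "x \<in> {0, l}" "y \<in> {1..n - 1}" for x y
    proof (cases "x = 0")
      case True
      have "g (0, y) \<ge> 0" using that by (simp add: g_def)
      moreover have "f (0, y) = 0" using dirichlet_left that c by auto
      ultimately show ?thesis using True by simp
    next
      case False
      then have "x = l" using that by simp
      have "real_of_int (y * (n - y)) \<ge> 0" using that(2) by (subst of_int_0_le_iff) simp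
      then have "1 \<le> g (l, y)" using c by (simp add: g_def)
      then show ?thesis using dirichlet_right that(2) \<open>x = l\<close> by simp
    qed
    show "(c, y) \<in> rect l n" using c y by (simp add: rect_def)
  qed (rule dirichlet_harmonic)
  then show ?thesis by (simp add: g_def)
qed

lemma dirichlet_bound_left_part:
  assumes n: "n \<ge> 2" and m: "m \<in> {1..l - 1}" and x: "x \<in> {1..m}" and y: "y \<in> {1..n - 1}"
  shows "f (x, y) \<le> of_int (x * y * n) / (of_int m * (of_int (l - m))\<^sup>2)"
proof -
  \<comment> \<open>The factor in front of \<open>x y\<close> makes the value at
    \<open>x = m\<close> equal to \<open>y n / (l - m)^2\<close>, which dominates the bound known on
    that line.\<close>
  define g :: "int \<times> int \<Rightarrow> real"
    where "g = (\<lambda>(x, y). of_int (x * y * n) / (of_int m * (of_int (l - m))\<^sup>2))"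
  have at_m: "f (m, y) \<le> g (m, y)" if "y \<in> {1..n - 1}" for y
  proof -
    have "y * (n - y) \<le> y * n" using that by (intro mult_left_mono) auto
    then have "real_of_int (y * (n - y)) / (of_int (l - m))\<^sup>2 \<le> of_int (y * n) / (of_int (l - m))\<^sup>2"
      by (intro divide_right_mono) (simp_all only: of_int_le_iff zero_le_power2)
    also have "\<dots> = g (m, y)" using m by (simp add: g_def)
    finally show ?thesis using dirichlet_bound_vertical_line[OF n m that] by linarith
  qed
  have "f (x, y) \<le> g (x, y)"
  \<comment> \<open>The column \<open>x = m\<close> is a side of the smaller rectangle, not part of
    its interior, so \<open>at_m\<close> covers it directly.\<close>
  proof (cases "x = m")
    case True
    then show ?thesis using at_m[OF y] by simp
  next
    case False
    show ?thesis
    proof (rule rect_comparison[of m n])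
      show "discrete_laplacian f z = 0" if "z \<in> rect m n" for z
        using that m by (intro dirichlet_harmonic) (auto simp: rect_def)
      show "discrete_laplacian g z = 0" for z
        by (cases z) (simp add: discrete_laplacian_eq g_def
            add_divide_distrib[symmetric] diff_divide_distrib[symmetric] algebra_simps)
      show "f (x, y) \<le> g (x, y)" if "x \<in> {1..m - 1}" "y \<in> {0, n}" for x y
        using that dirichlet_horizontal[OF n _ that(2), of x] m n by (auto simp: g_def)
      show "f (x, y) \<le> g (x, y)" if "x \<in> {0, m}" "y \<in> {1..n - 1}" for x y
        using that at_m dirichlet_left[OF _ that(2)] m by (auto simp: g_def)
      show "(x, y) \<in> rect m n" using x y False by (simp add: rect_def)
    qed
  qed
  then show ?thesis by (simp add: g_def)
qed

end

theorem lemma6p4: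
  fixes a :: real
  assumes "a > 0"
  shows "\<exists>K::real. K > 0 \<and>
    (\<forall>n::int. n \<ge> 2 \<longrightarrow> \<lfloor>a * real_of_int n\<rfloor> \<ge> 2 \<longrightarrow>
      (\<forall>f::int \<times> int \<Rightarrow> real. rect_dirichlet_solution \<lfloor>a * real_of_int n\<rfloor> n f \<longrightarrow>
        (\<forall>y\<in>{1..n - 1}. f (1, y) \<le> K * (real_of_int y / (real_of_int n)\<^sup>2))))"
\<comment> \<open>With \<open>r = a n\<close>, the bounds \<open>m \<ge> r / 6\<close> and
  \<open>l - m \<ge> r / 4\<close> below give the constant 96 = 6 * 4 * 4.\<close>
proof (intro exI[of _ "96 / a ^ 3"] conjI allI impI ballI)
  show "96 / a ^ 3 > 0" using assms by simp
next
  fix n :: int and f :: "int \<times> int \<Rightarrow> real" and y :: int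
  assume n: "n \<ge> 2" and l2: "\<lfloor>a * real_of_int n\<rfloor> \<ge> 2"
    and sol: "rect_dirichlet_solution \<lfloor>a * real_of_int n\<rfloor> n f" and y: "y \<in> {1..n - 1}"
  define l where "l = \<lfloor>a * real_of_int n\<rfloor>"
  define m where "m = l div 2"
  define r where "r = a * real_of_int n"
  have "l \<ge> 2" using l2 by (simp add: l_def)
  \<comment> \<open>Rounding down costs most at \<open>l = 3\<close>, \<open>m = 1\<close>, where
    \<open>3 * m = l\<close> holds with equality.\<close>
  then have m: "m \<in> {1..l - 1}" "3 * m \<ge> l" "2 * (l - m) \<ge> l" by (auto simp: m_def)
  \<comment> \<open>The loss from the floor is absorbed into a factor 2, since
    \<open>l + 1 \<le> 2 l\<close>.\<close>
  have "r < of_int l + 1" by (simp add: l_def r_def)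
  with \<open>l \<ge> 2\<close> have l_ge: "of_int l \<ge> r / 2" by linarith
  have "r > 0" using assms n by (simp add: r_def)
  have "real_of_int l \<le> of_int (3 * m)" "real_of_int l \<le> of_int (2 * (l - m))"
    using m(2,3) by (simp_all only: of_int_le_iff)
  then have "r / 6 \<le> of_int m" and "r / 4 \<le> of_int (l - m)"
    using l_ge by simp_all
  then have "r / 6 * (r / 4)\<^sup>2 \<le> of_int m * (of_int (l - m))\<^sup>2"
    using \<open>r > 0\<close> by (intro mult_mono power_mono) auto
  then have den: "r ^ 3 / 96 \<le> of_int m * (of_int (l - m))\<^sup>2"
    by (simp add: power2_eq_square power3_eq_cube)
  have "f (1, y) \<le> of_int (1 * y * n) / (of_int m * (of_int (l - m))\<^sup>2)"
    using m y n sol by (intro dirichlet_bound_left_part) (auto simp: l_def)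
  also have "\<dots> \<le> of_int (1 * y * n) / (r ^ 3 / 96)"
    using den \<open>r > 0\<close> y n m(1) by (intro divide_left_mono mult_pos_pos) auto
  \<comment> \<open>The denominator contains \<open>n ^ 3\<close>, and the factor \<open>n\<close>
    in the numerator cancels one power.\<close>
  also have "\<dots> = 96 / a ^ 3 * (of_int y / (of_int n)\<^sup>2)"
    using n assms by (simp add: r_def field_simps power2_eq_square power3_eq_cube)
  finally show "f (1, y) \<le> 96 / a ^ 3 * (of_int y / (of_int n)\<^sup>2)" .
qed

end
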